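(* Let $\mathcal H$ be a finite-dimensional complex Hilbert space and let $\mathcal K$ be a subset of the set of Lindbladians on $\mathbb B(\mathcal H)$. Let $\sigma\in\mathcal D(\mathcal H)$. Suppose there is a Lindbladian vector field in $\mathcal K$, i.e. an assignment $\eta\mapsto L_\eta\in\mathcal K$ for $\eta\in\mathcal D(\mathcal H)$, such that for all $\eta\in\mathcal D(\mathcal H)$ with $\eta\neq\sigma$, $$\langle L_\eta(\eta),\sigma-\eta\rangle_{HS}>0 .$$ Then $\mathcal K$ reaches $\sigma$.
   Context: $\mathbb B(\mathcal H)$ is the algebra of linear operators on $\mathcal H$; $\mathcal D(\mathcal H)=\{\rho\in\mathbb B(\mathcal H):\rho=\rho^*,\rho\ge 0,\mathrm{tr}\,\rho=1\}$; $\langle x,y\rangle_{HS}=\mathrm{tr}(x^*y)$. A Lindbladian is a linear map on $\mathbb B(\mathcal H)$ of the form $L(\rho)=-i[H,\rho]+\sum_{j=1}^n\big(L_j\rho L_j^*-\tfrac12(L_j^*L_j\rho+\rho L_j^*L_j)\big)$ with $H=H^*$ and $L_j\in\mathbb B(\mathcal H)$. An evolution $(T_t)_{t\ge 0}$ (maps on $\mathbb B(\mathcal H)$ with $T_0=\mathrm{id}$) is admissible to $\mathcal K$ if there is a family $L_t\in\mathcal K$, for all $t$, such that $T_t$ is a weak solution of $\dot T_t=L_tT_t$. $\mathcal K$ reaches $\sigma$ if for every initial state $\rho\in\mathcal D(\mathcal H)$ there is a time-dependent Lindbladian evolution $T_t$ admissible to $\mathcal K$ with $\lim_{t\to\infty}T_t(\rho)=\sigma$.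 *)

theory Defs
  imports "HOL-Analysis.Analysis" "HOL-Library.Complex_Order"
begin

text \<open>A finite-dimensional complex Hilbert space is taken, in an orthonormal basis indexed by
  the finite type \<open>'n\<close>, to be \<open>complex ^ 'n\<close>; its operators are the square matrices.
  Dimension zero is excluded by this, but there the set of density operators is empty.
  Comparisons of complex numbers with zero are those of \<open>Complex_Order\<close>:
  \<open>0 \<le> z\<close> and \<open>0 < z\<close> include that \<open>z\<close> is real.\<close>

type_synonym 'n operator = "complex ^ 'n ^ 'n"

type_synonym 'n superoperator = "'n operator \<Rightarrow> 'n operator"

definition cadjoint :: "'n::finite operator \<Rightarrow> 'n operator" where
  "cadjoint A = map_matrix cnj (transpose A)"

definition cscale :: "complex \<Rightarrow> 'n::finite operator \<Rightarrow> 'n operator" where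
  "cscale c A = map_matrix ((*) c) A"

lemma vector_space_cscale: "vector_space (cscale :: complex \<Rightarrow> 'n::finite operator \<Rightarrow> _)"
  by standard (simp_all add: cscale_def map_matrix_def vec_eq_iff algebra_simps)

definition cinner :: "complex ^ 'n::finite \<Rightarrow> complex ^ 'n \<Rightarrow> complex" where
  "cinner v w = (\<Sum>i\<in>UNIV. cnj (v $ i) * w $ i)"

definition hs_inner :: "'n::finite operator \<Rightarrow> 'n operator \<Rightarrow> complex" where
  "hs_inner A B = trace (cadjoint A ** B)"

definition selfadjoint_op :: "'n::finite operator \<Rightarrow> bool" where
  "selfadjoint_op A \<longleftrightarrow> A = cadjoint A"

definition positive_op :: "'n::finite operator \<Rightarrow> bool" where
  "positive_op A \<longleftrightarrow> (\<forall>v. 0 \<le> cinner v (A *v v))"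

definition density_ops :: "'n::finite operator set" where
  "density_ops = {\<rho>. selfadjoint_op \<rho> \<and> positive_op \<rho> \<and> trace \<rho> = 1}"

definition lindblad_form ::
    "'n::finite operator \<Rightarrow> nat \<Rightarrow> (nat \<Rightarrow> 'n operator) \<Rightarrow> 'n superoperator" where
  "lindblad_form H n V \<rho> =
     cscale (- \<i>) (H ** \<rho> - \<rho> ** H) +
     (\<Sum>j=1..n. V j ** \<rho> ** cadjoint (V j)
        - cscale (1/2) (cadjoint (V j) ** V j ** \<rho> + \<rho> ** cadjoint (V j) ** V j))"

definition lindbladians :: "'n::finite superoperator set" where
  "lindbladians = {lindblad_form H n V | H n V. selfadjoint_op H}"

definition evolution :: "(real \<Rightarrow> 'n::finite superoperator) \<Rightarrow> bool" where
  "evolution T \<longleftrightarrow> (\<forall>t\<ge>0. Vector_Spaces.linear cscale cscale (T t)) \<and> T 0 = id"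

text \<open>Weak solutions of \<open>dT\<^sub>t/dt = L\<^sub>t T\<^sub>t\<close> are understood in the Caratheodory sense:
  the integrand \<open>s \<mapsto> L\<^sub>s T\<^sub>s\<close> is Lebesgue integrable on bounded time intervals and
  the integrated equation \<open>T\<^sub>t = T\<^sub>0 + \<integral>\<^sub>0\<^sup>t L\<^sub>s T\<^sub>s ds\<close> holds, both stated pointwise on operators.
  Given this integrability, it is equivalent that \<open>T\<close> is continuous in time and solves the
  equation in the sense of distributions; no continuity of \<open>L\<close> in time is required.\<close>

definition weak_solution ::
    "(real \<Rightarrow> 'n::finite superoperator) \<Rightarrow> (real \<Rightarrow> 'n superoperator) \<Rightarrow> bool" where
  "weak_solution L T \<longleftrightarrow>
     (\<forall>x. \<forall>t\<ge>0. (\<lambda>s. L s (T s x)) absolutely_integrable_on {0..t} \<and>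
        T t x = T 0 x + integral {0..t} (\<lambda>s. L s (T s x)))"

definition admissible ::
    "'n::finite superoperator set \<Rightarrow> (real \<Rightarrow> 'n superoperator) \<Rightarrow> bool" where
  "admissible K T \<longleftrightarrow>
     evolution T \<and> (\<exists>L. (\<forall>t\<ge>0. L t \<in> K) \<and> weak_solution L T)"

definition reaches :: "'n::finite superoperator set \<Rightarrow> 'n operator \<Rightarrow> bool" where
  "reaches K \<sigma> \<longleftrightarrow>
     (\<forall>\<rho>\<in>density_ops. \<exists>T. admissible K T \<and> ((\<lambda>t. T t \<rho>) \<longlongrightarrow> \<sigma>) at_top)"

end

theory Submission
  imports Defs
begin

text \<open>Near a state \<open>\<eta> \<noteq> \<sigma>\<close> the fixed Lindbladian \<open>L \<eta>\<close> decreases the distance to \<open>\<sigma>\<close> at a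
  positive rate, and near \<open>\<sigma>\<close> the semigroup of \<open>L \<sigma>\<close> stays close to \<open>\<sigma>\<close> for a short time. As the
  set of density operators is compact and invariant under Lindbladian semigroups, for every
  tolerance \<open>e\<close> there is a dwell time \<open>h\<close> that suits all states: some element of \<open>K\<close> applied for time
  \<open>h\<close> either lowers the squared distance by \<open>h\<^sup>2\<close> or ends within tolerance. Switching at
  the times \<open>\<surd>k\<close>, the dwell times tend to zero, so the tolerance can be sent to zero along the way,
  while the guaranteed decrements are at least of order \<open>1/k\<close> and hence sum to infinity. The times
  themselves tend to infinity, so the evolution is defined for all \<open>t \<ge> 0\<close> although the norms of the
  operators \<open>L \<eta>\<close> need not be bounded. Piecewise constant controls also cope with \<open>L\<close> being
  discontinuous.\<close>

section \<open>Exponential of a bounded operator\<close>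

text \<open>The exponential series of \<open>t A\<close> applied to \<open>x\<close>. As
  \<open>A\<close> stays a plain function, members of \<open>K\<close> can be inserted
  directly.\<close>

definition flow :: "('a::euclidean_space \<Rightarrow> 'a) \<Rightarrow> real \<Rightarrow> 'a \<Rightarrow> 'a" where
  "flow A t x = (\<Sum>k. (t ^ k / fact k) *\<^sub>R (A ^^ k) x)"

lemma flow_0 [simp]: "flow A 0 x = x"
  unfolding flow_def by (subst suminf_finite[of "{0}"]) auto

lemma summable_flow:
  fixes A :: "'a::euclidean_space \<Rightarrow> 'a"
  assumes "bounded_linear A"
  shows "summable (\<lambda>k. (t ^ k / fact k) *\<^sub>R (A ^^ k) x)"
proof -
  obtain B where B: "B > 0" "\<And>x. norm (A x) \<le> norm x * B"
    using bounded_linear.pos_bounded[OF assms] by blast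
  have pow: "norm ((A ^^ k) x) \<le> B ^ k * norm x" for k
  proof (induction k)
    case (Suc k)
    have "norm ((A ^^ Suc k) x) \<le> norm ((A ^^ k) x) * B" using B(2)[of "(A ^^ k) x"] by simp
    also have "\<dots> \<le> (B ^ k * norm x) * B" using Suc B by (intro mult_right_mono) auto
    finally show ?case by (simp add: algebra_simps)
  qed simp
  have "summable (\<lambda>k. (inverse (fact k) * (\<bar>t\<bar> * B) ^ k) * norm x)"
    by (intro summable_mult2 summable_exp)
  then show ?thesis
  proof (rule summable_comparison_test'[where N = 0])
    fix k
    have "norm ((t ^ k / fact k) *\<^sub>R (A ^^ k) x) \<le> (\<bar>t\<bar> ^ k / fact k) * (B ^ k * norm x)"
      using mult_left_mono[OF pow[of k], of "\<bar>t\<bar> ^ k / fact k"] by (simp add: power_abs)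
    then show "norm ((t ^ k / fact k) *\<^sub>R (A ^^ k) x)
        \<le> (inverse (fact k) * (\<bar>t\<bar> * B) ^ k) * norm x"
      by (simp add: field_simps)
  qed
qed

text \<open>Used with \<open>P\<close> equal to \<open>A\<close> itself (for the derivative), to
  \<open>cadjoint\<close> (self-adjointness is preserved) and to \<open>cscale c\<close> (complex
  linearity).\<close>

lemma flow_commute:
  assumes "bounded_linear A" "bounded_linear P" "\<And>x. P (A x) = A (P x)"
  shows "flow A t (P x) = P (flow A t x)"
proof -
  have pow: "(A ^^ k) (P x) = P ((A ^^ k) x)" for k
    by (induction k) (simp_all add: assms(3))
  show ?thesis
    unfolding flow_def bounded_linear.suminf[OF assms(2) summable_flow[OF assms(1)]]
    by (simp add: pow linear_cmul[OF bounded_linear.linear[OF assms(2)]])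
qed

lemma flow_add:
  assumes "bounded_linear A"
  shows "flow A t (x + y) = flow A t x + flow A t y"
proof -
  have pow: "(A ^^ k) (x + y) = (A ^^ k) x + (A ^^ k) y" for k
    by (induction k) (simp_all add: linear_add[OF bounded_linear.linear[OF assms]])
  show ?thesis
    unfolding flow_def
    by (simp add: pow scaleR_add_right suminf_add[OF summable_flow[OF assms] summable_flow[OF assms]])
qed

text \<open>Paired with any \<open>b\<close>, the flow is a scalar power series converging
  everywhere, so it may be differentiated term by term.\<close>

lemma flow_has_vector_derivative:
  assumes "bounded_linear A"
  shows "((\<lambda>t. flow A t x) has_vector_derivative A (flow A t x)) (at t)"
proof -
  have inner_eq: "flow A t y \<bullet> b = (\<Sum>k. ((A ^^ k) y \<bullet> b / fact k) * t ^ k)"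
    and smb: "summable (\<lambda>k. ((A ^^ k) y \<bullet> b / fact k) * t ^ k)" for t y b
    using bounded_linear.suminf[OF bounded_linear_inner_left summable_flow[OF assms], of t y b]
      bounded_linear.summable[OF bounded_linear_inner_left summable_flow[OF assms], of t y b]
    by (simp_all add: flow_def mult.commute)
  have "((\<lambda>t. flow A t x \<bullet> b) has_field_derivative flow A t (A x) \<bullet> b) (at t)" for b
  proof -
    \<comment> \<open>The index shift cancels one factor of the factorial and moves one application
      of \<open>A\<close> onto \<open>x\<close>.\<close>
    have "diffs (\<lambda>k. (A ^^ k) x \<bullet> b / fact k) = (\<lambda>k. (A ^^ k) (A x) \<bullet> b / fact k)"
      by (rule ext) (simp add: diffs_def funpow_swap1 field_simps del: of_nat_Suc)
    then show ?thesis
      using termdiffs_strong_converges_everywhere[OF smb, of x b t]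
      by (simp add: inner_eq)
  qed
  then have "((\<lambda>t. flow A t x) has_derivative (\<lambda>s. s *\<^sub>R flow A t (A x))) (at t)"
    by (subst has_derivative_componentwise_within)
      (simp add: has_field_derivative_def mult_commute_abs)
  then show ?thesis
    by (simp add: has_vector_derivative_def flow_commute[OF assms assms])
qed

section \<open>Steering on a compact invariant set\<close>

text \<open>Take for \<open>e k\<close> the smallest of \<open>R\<close>, \<open>R / 2\<close>, ...,
  \<open>R / (k + 1)\<close> that satisfies \<open>P k\<close>. The cutoff \<open>n \<le> k\<close>
  makes the set of candidates finite, and \<open>P k R\<close> makes it nonempty.\<close>

lemma diagonal_tolerance:
  fixes P :: "nat \<Rightarrow> real \<Rightarrow> bool" and R :: real
  assumes "R > 0" "\<And>k. P k R" and ev: "\<And>e. e > 0 \<Longrightarrow> eventually (\<lambda>k. P k e) sequentially"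
  shows "\<exists>e. e \<longlonglongrightarrow> 0 \<and> (\<forall>k. P k (e k))"
proof -
  define N where "N k = {n. n \<le> k \<and> P k (R / real (Suc n))}" for k
  define lev where "lev k = Max (N k)" for k
  have fin: "finite (N k)" for k by (rule finite_subset[of _ "{..k}"]) (auto simp: N_def)
  have "lev k \<in> N k" for k
    unfolding lev_def using assms(2)[of k] by (intro Max_in fin) (auto simp: N_def)
  then have P: "P k (R / real (Suc (lev k)))" for k by (auto simp: N_def)
  have "filterlim lev at_top sequentially"
  proof (subst filterlim_at_top, intro allI)
    fix n
    have "eventually (\<lambda>k. P k (R / real (Suc n)) \<and> n \<le> k) sequentially"
      using ev[of "R / real (Suc n)"] assms(1) by (intro eventually_conj eventually_ge_at_top) auto
    then show "eventually (\<lambda>k. n \<le> lev k) sequentially"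
      by eventually_elim (auto simp: lev_def N_def intro!: Max_ge)
  qed
  then have "(\<lambda>k. R * inverse (real (Suc (lev k)))) \<longlonglongrightarrow> R * 0"
    by (intro tendsto_mult tendsto_const filterlim_compose[OF LIMSEQ_inverse_real_of_nat])
  then show ?thesis
    using P by (intro exI[of _ "\<lambda>k. R / real (Suc (lev k))"]) (simp add: divide_inverse)
qed

text \<open>Once \<open>e\<close> is below \<open>r / 2\<close>, every step that ends above
  \<open>r / 2\<close> must lower \<open>a\<close> by \<open>w\<close>, which cannot go on forever
  as the sum of \<open>w\<close> diverges. After \<open>a\<close> has fallen to
  \<open>r / 2\<close>, both branches of the maximum keep it at or below that level.\<close>

lemma tendsto_0_of_decrements:
  fixes a e w :: "nat \<Rightarrow> real"
  assumes nonneg: "\<And>k. 0 \<le> a k" "\<And>k. 0 \<le> w k"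
    and step: "\<And>k. a (Suc k) \<le> max (e k) (a k - w k)"
    and e: "e \<longlonglongrightarrow> 0" and w: "\<not> summable w"
  shows "a \<longlonglongrightarrow> 0"
proof (rule LIMSEQ_I, goal_cases)
  case (1 r)
  obtain k0 where k0: "\<And>k. k \<ge> k0 \<Longrightarrow> e k < r / 2"
    using order_tendstoD(2)[OF e, of "r / 2"] 1 by (auto simp: eventually_sequentially)
  have "\<exists>k\<ge>k0. a k \<le> r / 2"
  proof (rule ccontr)
    assume "\<not> ?thesis"
    then have big: "a k > r / 2" if "k \<ge> k0" for k using that by force
    have dec: "w (n + k0) \<le> a (n + k0) - a (Suc n + k0)" for n
      using step[of "n + k0"] big[of "Suc (n + k0)"] k0[of "n + k0"] by auto
    have sums: "(\<Sum>i<n. w (i + k0)) \<le> a k0 - a (n + k0)" for n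
    proof (induction n)
      case (Suc n)
      then show ?case using dec[of n] by simp
    qed simp
    have "(\<Sum>i<n. w (i + k0)) \<le> a k0" for n
      using sums[of n] nonneg(1)[of "n + k0"] by linarith
    then have "summable (\<lambda>i. w (i + k0))"
      by (intro summableI_nonneg_bounded[of _ "a k0"] nonneg)
    then show False using w summable_iff_shift[of w k0] by blast
  qed
  then obtain k1 where k1: "k1 \<ge> k0" "a k1 \<le> r / 2" by blast
  have "a k \<le> r / 2" if "k \<ge> k1" for k
    using that
  proof (induction k rule: dec_induct)
    case (step n)
    then show ?case
      using assms(3)[of n] k0[of n] k1 nonneg(2)[of n] by (auto simp: max_def split: if_splits)
  qed (use k1 in auto)
  then show ?case using 1 nonneg(1) by (intro exI[of _ k1]) (fastforce simp: abs_of_nonneg)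
qed

text \<open>The gap is at least \<open>1 / (2 * sqrt (k + 1))\<close>, so its square dominates a
  quarter of a harmonic term.\<close>

lemma sqrt_gap_squares_not_summable: "\<not> summable (\<lambda>k. (sqrt (real (Suc k)) - sqrt (real k))\<^sup>2)"
proof
  assume s: "summable (\<lambda>k. (sqrt (real (Suc k)) - sqrt (real k))\<^sup>2)"
  have le: "norm (inverse (real (Suc k)) / 4) \<le> (sqrt (real (Suc k)) - sqrt (real k))\<^sup>2" for k
  proof -
    let ?a = "sqrt (real (Suc k))" and ?b = "sqrt (real k)"
    have ab: "0 \<le> ?b" "?b \<le> ?a" "0 < ?a" by auto
    have "1 = ?a\<^sup>2 - ?b\<^sup>2" by simp
    also have "\<dots> = (?a - ?b) * (?a + ?b)" by (simp add: power2_eq_square algebra_simps)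
    also have "\<dots> \<le> (?a - ?b) * (2 * ?a)" using ab by (intro mult_left_mono) auto
    finally have "1 / (2 * ?a) \<le> ?a - ?b" using ab by (simp add: field_simps del: of_nat_Suc)
    then have "(1 / (2 * ?a))\<^sup>2 \<le> (?a - ?b)\<^sup>2" using ab by (intro power_mono) auto
    then show ?thesis by (simp add: power_divide power_mult_distrib inverse_eq_divide mult.commute)
  qed
  have "summable (\<lambda>k. inverse (real (Suc k)) / 4)"
    by (rule summable_comparison_test'[OF s, of 0]) (use le in auto)
  then have "summable (\<lambda>k. inverse (real (Suc k)))"
    using summable_mult[of "\<lambda>k. inverse (real (Suc k)) / 4" 4] by simp
  then show False
    using not_summable_harmonic[where 'a = real] summable_Suc_iff[of "\<lambda>k. inverse (real k)"] by simp
qed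

text \<open>The steering argument is real Euclidean geometry: the pairing in \<open>descent\<close>
  is minus half the derivative at \<open>x\<close> of the squared distance to \<sigma> along
  \<open>L x\<close>.\<close>

locale controlled_flow =
  fixes D :: "'a::euclidean_space set" and K :: "('a \<Rightarrow> 'a) set" and \<sigma> :: 'a
    and L :: "'a \<Rightarrow> 'a \<Rightarrow> 'a"
  assumes compact: "compact D"
    and linear: "\<And>A. A \<in> K \<Longrightarrow> bounded_linear A"
    and invariant: "\<And>A x t. A \<in> K \<Longrightarrow> x \<in> D \<Longrightarrow> 0 \<le> t \<Longrightarrow> flow A t x \<in> D"
    and control: "\<And>x. x \<in> D \<Longrightarrow> L x \<in> K"
    and descent: "\<And>x. x \<in> D \<Longrightarrow> x \<noteq> \<sigma> \<Longrightarrow> 0 < L x x \<bullet> (\<sigma> - x)"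
begin

text \<open>\<open>h\<close> is both the dwell time and the guaranteed rate of descent, so a full
  dwell gains \<open>h\<close> squared and a smaller \<open>h\<close> only weakens the property. All
  intermediate \<open>s\<close> are included in order to control the distance between
  switches.\<close>

definition steers :: "real \<Rightarrow> real \<Rightarrow> 'a \<Rightarrow> ('a \<Rightarrow> 'a) \<Rightarrow> bool" where
  "steers e h x A \<longleftrightarrow>
     (\<forall>s\<in>{0..h}. (dist (flow A s x) \<sigma>)\<^sup>2 \<le> max e ((dist x \<sigma>)\<^sup>2 - h * s))"

lemma steers_mono:
  assumes "steers e h' x A" "h \<le> h'"
  shows "steers e h x A"
  unfolding steers_def
proof
  fix s assume s: "s \<in> {0..h}"
  then have "(dist (flow A s x) \<sigma>)\<^sup>2 \<le> max e ((dist x \<sigma>)\<^sup>2 - h' * s)"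
    using assms by (auto simp: steers_def)
  moreover have "h * s \<le> h' * s" using s assms by (intro mult_right_mono) auto
  ultimately show "(dist (flow A s x) \<sigma>)\<^sup>2 \<le> max e ((dist x \<sigma>)\<^sup>2 - h * s)" by auto
qed

text \<open>Orbits from \<open>D\<close> stay in the bounded set \<open>D\<close>, so their speed is
  uniformly bounded and the mean value inequality applies.\<close>

lemma displacement_bound:
  assumes "A \<in> K"
  obtains C where "C > 0" "\<And>x s. x \<in> D \<Longrightarrow> 0 \<le> s \<Longrightarrow> dist (flow A s x) x \<le> C * s"
proof -
  obtain B where B: "B > 0" "\<And>x. norm (A x) \<le> norm x * B"
    using bounded_linear.pos_bounded[OF linear[OF assms]] by blast
  obtain M where M: "M > 0" "\<And>x. x \<in> D \<Longrightarrow> norm x \<le> M"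
    using compact_imp_bounded[OF compact] by (auto simp: bounded_pos)
  show thesis
  proof (rule that[of "M * B"])
    fix x and s :: real assume x: "x \<in> D" and s: "0 \<le> s"
    have "norm (flow A s x - flow A 0 x) \<le> (M * B) * norm (s - 0)"
    proof (rule differentiable_bound)
      show "convex {0..s}" by simp
      show "((\<lambda>t. flow A t x) has_derivative (\<lambda>u. u *\<^sub>R A (flow A t x))) (at t within {0..s})" for t
        using flow_has_vector_derivative[OF linear[OF assms], of x t]
        by (simp add: has_vector_derivative_def has_derivative_at_withinI)
      fix t assume t: "t \<in> {0..s}"
      have "norm (A (flow A t x)) \<le> norm (flow A t x) * B" by (rule B)
      also have "\<dots> \<le> M * B" using B M(2)[OF invariant[OF assms x]] t by (intro mult_right_mono) auto
      finally show "onorm (\<lambda>u. u *\<^sub>R A (flow A t x)) \<le> M * B"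
        by (intro onorm_le) (simp add: mult.commute mult_left_mono)
    qed (use s in auto)
    then show "dist (flow A s x) x \<le> M * B * s" using s by (simp add: dist_norm)
  qed (use M B in auto)
qed

lemma steers_locally:
  assumes y: "y \<in> D" and e: "e > 0"
  obtains r h where "r > 0" "h > 0" "\<And>x. x \<in> D \<Longrightarrow> dist x y < r \<Longrightarrow> steers e h x (L y)"
proof -
  let ?A = "L y"
  have A: "?A \<in> K" using control[OF y] .
  obtain C where C: "C > 0" "\<And>x s. x \<in> D \<Longrightarrow> 0 \<le> s \<Longrightarrow> dist (flow ?A s x) x \<le> C * s"
    using displacement_bound[OF A] by blast
  \<comment> \<open>Half of the radius is spent on the starting point, the other half on the
    displacement.\<close>
  have near: "dist (flow ?A s x) y < r" if "x \<in> D" "dist x y < r / 2" "0 \<le> s" "s \<le> r / (2 * C)" for x s r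
  proof -
    have "C * s \<le> r / 2" using that C(1) by (simp add: field_simps)
    then show ?thesis
      using C(2)[OF that(1,3)] that(2) dist_triangle[of "flow ?A s x" y x] by linarith
  qed
  show thesis
  proof (cases "y = \<sigma>")
    case True
    show thesis
    proof (rule that[of "sqrt e / 2" "sqrt e / (2 * C)"])
      fix x assume x: "x \<in> D" "dist x y < sqrt e / 2"
      have "(dist (flow ?A s x) \<sigma>)\<^sup>2 \<le> e" if s: "s \<in> {0..sqrt e / (2 * C)}" for s
        using near[OF x, of s] s True power_mono[of "dist (flow ?A s x) \<sigma>" "sqrt e" 2] e by auto
      then show "steers e (sqrt e / (2 * C)) x ?A" by (auto simp: steers_def le_max_iff_disj)
    qed (use e C in auto)
  next
    case False
    let ?g = "\<lambda>x. ?A x \<bullet> (\<sigma> - x)"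
    define a where "a = ?g y / 2"
    have a: "a > 0" "a < ?g y" using descent[OF y False] by (auto simp: a_def)
    have "isCont ?g y"
      by (intro continuous_intros bounded_linear.isCont[OF linear[OF A]])
    then have "eventually (\<lambda>x. a < ?g x) (at y)"
      using a by (intro order_tendstoD) (auto simp: isCont_def)
    \<comment> \<open>The filter \<open>at y\<close> omits \<open>y\<close> itself; there the bound
      is \<open>a(2)\<close>.\<close>
    then obtain r where r: "r > 0" "\<And>x. dist x y < r \<Longrightarrow> a < ?g x"
      unfolding eventually_at using a(2) by (metis UNIV_I)
    \<comment> \<open>The first bound keeps orbits in the ball; the second keeps the rate demanded
      by \<open>steers\<close> at most the available rate \<open>2 * a\<close>.\<close>
    define h where "h = min (r / (2 * C)) (2 * a)"
    show thesis
    proof (rule that[of "r / 2" h])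
      fix x assume x: "x \<in> D" "dist x y < r / 2"
      have "(dist (flow ?A s x) \<sigma>)\<^sup>2 \<le> (dist x \<sigma>)\<^sup>2 - h * s" if s: "s \<in> {0..h}" for s
      proof -
        let ?f = "\<lambda>u. (flow ?A u x - \<sigma>) \<bullet> (flow ?A u x - \<sigma>) + 2 * a * u"
        have "?f 0 \<ge> ?f s"
        proof (rule DERIV_nonpos_imp_nonincreasing[of 0 s ?f])
          fix u assume u: "0 \<le> u" "u \<le> s"
          have g: "a < ?g (flow ?A u x)"
            using u s by (intro r(2) near[OF x]) (auto simp: h_def)
          have "((\<lambda>u. flow ?A u x - \<sigma>) has_vector_derivative ?A (flow ?A u x)) (at u)"
            by (simp add: has_vector_derivative_diff_const flow_has_vector_derivative linear[OF A])
          from bounded_bilinear.has_vector_derivative[OF bounded_bilinear_inner this this]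
          have "DERIV (\<lambda>u. (flow ?A u x - \<sigma>) \<bullet> (flow ?A u x - \<sigma>)) u :>
              (flow ?A u x - \<sigma>) \<bullet> ?A (flow ?A u x) + ?A (flow ?A u x) \<bullet> (flow ?A u x - \<sigma>)"
            by (simp only: has_real_derivative_iff_has_vector_derivative)
          from DERIV_add[OF this DERIV_cmult_Id[of "2 * a"]]
          have "DERIV ?f u :> 2 * (a - ?g (flow ?A u x))"
            by (rule DERIV_cong) (simp add: inner_diff inner_commute)
          then show "\<exists>d. DERIV ?f u :> d \<and> d \<le> 0" using g by (intro exI conjI) auto
        qed (use s in auto)
        moreover have "h * s \<le> 2 * a * s" using s by (intro mult_right_mono) (auto simp: h_def)
        ultimately show ?thesis by (simp add: dist_norm power2_norm_eq_inner)
      qed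
      then show "steers e h x ?A" by (auto simp: steers_def le_max_iff_disj)
    qed (use r a C in \<open>auto simp: h_def\<close>)
  qed
qed

text \<open>If the dwell times \<open>1 / (n + 1)\<close> failed at points \<open>x n\<close>, a
  subsequence would converge to some \<open>y\<close> in \<open>D\<close>, and the local dwell time
  at \<open>y\<close> would serve its tail.\<close>

lemma steers_uniformly:
  assumes e: "e > 0"
  obtains h where "h > 0" "\<And>x. x \<in> D \<Longrightarrow> \<exists>A\<in>K. steers e h x A"
proof -
  have "\<exists>n. \<forall>x\<in>D. \<exists>A\<in>K. steers e (inverse (real (Suc n))) x A"
  proof (rule ccontr)
    assume "\<not> ?thesis"
    then have "\<forall>n. \<exists>x. x \<in> D \<and> (\<forall>A\<in>K. \<not> steers e (inverse (real (Suc n))) x A)" by blast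
    then obtain x where x: "\<And>n. x n \<in> D" "\<And>n A. A \<in> K \<Longrightarrow> \<not> steers e (inverse (real (Suc n))) (x n) A"
      by metis
    then obtain y \<phi> where y: "y \<in> D" and \<phi>: "strict_mono (\<phi> :: nat \<Rightarrow> nat)" "(x \<circ> \<phi>) \<longlonglongrightarrow> y"
      using compact unfolding compact_def by blast
    obtain r h where rh: "r > 0" "h > 0" "\<And>x. x \<in> D \<Longrightarrow> dist x y < r \<Longrightarrow> steers e h x (L y)"
      using steers_locally[OF y e] by blast
    have "eventually (\<lambda>n. inverse (real (Suc (\<phi> n))) < h) sequentially"
      using filterlim_compose[OF LIMSEQ_inverse_real_of_nat filterlim_subseq[OF \<phi>(1)]] rh(2)
      by (rule order_tendstoD)
    moreover have "eventually (\<lambda>n. dist (x (\<phi> n)) y < r) sequentially"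
      using tendstoD[OF \<phi>(2) rh(1)] by simp
    ultimately have "eventually (\<lambda>n. False) sequentially"
    proof eventually_elim
      case (elim n)
      then have "steers e (inverse (real (Suc (\<phi> n)))) (x (\<phi> n)) (L y)"
        using steers_mono[OF rh(3)[OF x(1)]] by (meson less_imp_le)
      then show ?case using x(2) control[OF y] by blast
    qed
    then show False by simp
  qed
  then show thesis using that by (metis inverse_positive_iff_positive of_nat_0_less_iff zero_less_Suc)
qed

text \<open>For a fixed tolerance, \<open>h k\<close> eventually drops below the uniform dwell time;
  the diagonal choice then lets the tolerance itself tend to zero.\<close>

lemma steers_along:
  fixes h :: "nat \<Rightarrow> real"
  assumes "h \<longlonglongrightarrow> 0"
  obtains e where "e \<longlonglongrightarrow> 0" "\<And>k x. x \<in> D \<Longrightarrow> \<exists>A\<in>K. steers (e k) (h k) x A"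
proof -
  obtain R where R: "R > 0" "\<And>x. x \<in> D \<Longrightarrow> dist x \<sigma> \<le> R"
    using bounded_subset_ballD[OF compact_imp_bounded[OF compact], of \<sigma>]
    by (metis dist_commute less_imp_le mem_ball subsetD)
  have "\<exists>e. e \<longlonglongrightarrow> 0 \<and> (\<forall>k. \<forall>x\<in>D. \<exists>A\<in>K. steers (e k) (h k) x A)"
  proof (rule diagonal_tolerance[of "R\<^sup>2"])
    fix k
    \<comment> \<open>The fallback tolerance of the diagonal argument: invariance confines the orbit
      to \<open>D\<close>, where the distance to \<sigma> is at most \<open>R\<close>.\<close>
    have "steers (R\<^sup>2) (h k) x (L x)" if "x \<in> D" for x
      using R(2)[OF invariant[OF control[OF that] that]]
      by (auto simp: steers_def le_max_iff_disj intro!: power_mono)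
    then show "\<forall>x\<in>D. \<exists>A\<in>K. steers (R\<^sup>2) (h k) x A" using control by blast
  next
    fix e :: real assume "e > 0"
    then obtain d where d: "d > 0" "\<And>x. x \<in> D \<Longrightarrow> \<exists>A\<in>K. steers e d x A"
      using steers_uniformly by blast
    show "eventually (\<lambda>k. \<forall>x\<in>D. \<exists>A\<in>K. steers e (h k) x A) sequentially"
      using order_tendstoD(2)[OF assms d(1)]
      by eventually_elim (use d(2) steers_mono in \<open>meson less_imp_le\<close>)
  qed (use R in auto)
  then show thesis using that by blast
qed

end

section \<open>Evolutions with piecewise constant generator\<close>

text \<open>With switches at the times \<open>sqrt k\<close>, the piece containing
  \<open>t \<ge> 0\<close> is numbered by the integer part of the square of
  \<open>t\<close>.\<close>

definition stage_index :: "real \<Rightarrow> nat" where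
  "stage_index t = nat \<lfloor>t\<^sup>2\<rfloor>"

primrec stage :: "(nat \<Rightarrow> 'a::euclidean_space \<Rightarrow> 'a) \<Rightarrow> nat \<Rightarrow> 'a \<Rightarrow> 'a" where
  "stage A 0 x = x"
| "stage A (Suc k) x = flow (A k) (sqrt (real (Suc k)) - sqrt (real k)) (stage A k x)"

definition switched_flow :: "(nat \<Rightarrow> 'a::euclidean_space \<Rightarrow> 'a) \<Rightarrow> real \<Rightarrow> 'a \<Rightarrow> 'a" where
  "switched_flow A t x =
     flow (A (stage_index t)) (t - sqrt (real (stage_index t))) (stage A (stage_index t) x)"

section \<open>Position of a time among the switches\<close>

lemma stage_index_eq:
  assumes "sqrt (real k) \<le> t" "t < sqrt (real (Suc k))"
  shows "stage_index t = k"
proof -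
  have t: "0 \<le> t" using assms(1) real_sqrt_ge_zero[of "real k"] by linarith
  have "real k \<le> t\<^sup>2" using assms(1) by (rule sqrt_le_D)
  moreover have "t\<^sup>2 < real (Suc k)"
    using assms(2) t real_less_rsqrt real_sqrt_less_iff real_sqrt_abs abs_of_nonneg by metis
  ultimately have "\<lfloor>t\<^sup>2\<rfloor> = int k" by (intro floor_unique) auto
  then show ?thesis by (simp add: stage_index_def)
qed

lemma stage_index_bounds:
  assumes "0 \<le> t"
  shows "sqrt (real (stage_index t)) \<le> t" "t < sqrt (real (Suc (stage_index t)))"
proof -
  have "real (stage_index t) \<le> t\<^sup>2" "t\<^sup>2 < real (Suc (stage_index t))"
    by (auto simp: stage_index_def) linarith
  then show "sqrt (real (stage_index t)) \<le> t" "t < sqrt (real (Suc (stage_index t)))"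
    using assms real_le_lsqrt real_less_rsqrt by auto
qed

text \<open>The right endpoint is included: there the next piece has run for time 0 and starts where
  this one ends. Continuity at the switches rests on this.\<close>

lemma switched_flow_eq:
  assumes "sqrt (real k) \<le> t" "t \<le> sqrt (real (Suc k))"
  shows "switched_flow A t x = flow (A k) (t - sqrt (real k)) (stage A k x)"
proof (cases "t = sqrt (real (Suc k))")
  case True
  have "stage_index t = Suc k" by (rule stage_index_eq) (auto simp: True)
  then show ?thesis by (simp add: switched_flow_def True del: of_nat_Suc)
next
  case False
  then have "stage_index t = k" using assms by (intro stage_index_eq) auto
  then show ?thesis by (simp add: switched_flow_def)
qed

lemma switched_flow_0 [simp]: "switched_flow A 0 x = x"
  using switched_flow_eq[of 0 0 A x] by simp

text \<open>The second condition on \<open>t\<close> excludes the switch times, 0 among them;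
  elsewhere the evolution agrees with one time-shifted flow on an open interval.\<close>

lemma switched_flow_has_vector_derivative:
  assumes "\<And>k. bounded_linear (A k)" and t: "0 \<le> t" "t \<noteq> sqrt (real (stage_index t))"
  shows "((\<lambda>s. switched_flow A s x) has_vector_derivative
           A (stage_index t) (switched_flow A t x)) (at t)"
proof -
  let ?k = "stage_index t"
  let ?f = "\<lambda>s. flow (A ?k) (s - sqrt (real ?k)) (stage A ?k x)"
  have in_piece: "t \<in> {sqrt (real ?k)<..<sqrt (real (Suc ?k))}"
    using stage_index_bounds[OF t(1)] t(2) by auto
  have "((\<lambda>s. s - sqrt (real ?k)) has_vector_derivative 1) (at t)"
    by (auto intro!: derivative_eq_intros)
  from vector_diff_chain_at[OF this flow_has_vector_derivative[OF assms(1)]]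
  have "(?f has_vector_derivative A ?k (?f t)) (at t)" by (simp add: o_def)
  then have "(?f has_vector_derivative A ?k (switched_flow A t x)) (at t)"
    by (simp add: switched_flow_def)
  then show ?thesis
    by (rule has_vector_derivative_transform_within_open[OF _ open_greaterThanLessThan in_piece])
      (rule switched_flow_eq[symmetric], auto)
qed

lemma continuous_on_switched_flow:
  assumes "\<And>k. bounded_linear (A k)"
  shows "continuous_on {0..t} (\<lambda>s. switched_flow A s x)"
proof -
  have "continuous_on {0..sqrt (real n)} (\<lambda>s. switched_flow A s x)" for n
  proof (induction n)
    case (Suc n)
    have "continuous_on UNIV (\<lambda>t. flow (A n) t (stage A n x))"
      using has_vector_derivative_continuous[OF flow_has_vector_derivative[OF assms]]
      by (intro continuous_at_imp_continuous_on) auto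
    then have "continuous_on {sqrt (real n)..sqrt (real (Suc n))}
        (\<lambda>s. flow (A n) (s - sqrt (real n)) (stage A n x))"
      by (rule continuous_on_compose2) (auto intro!: continuous_intros)
    then have "continuous_on {sqrt (real n)..sqrt (real (Suc n))} (\<lambda>s. switched_flow A s x)"
      by (rule continuous_on_eq) (auto intro!: switched_flow_eq[symmetric])
    moreover have "{0..sqrt (real (Suc n))} = {0..sqrt (real n)} \<union> {sqrt (real n)..sqrt (real (Suc n))}"
      by (rule ivl_disj_un_two_touch(4)[symmetric]) auto
    ultimately show ?case using Suc by (simp add: continuous_on_closed_Un del: of_nat_Suc)
  qed simp
  moreover have "{0..t} \<subseteq> {0..sqrt (real (Suc (stage_index t)))}"
    using stage_index_bounds(2)[of t] by force
  ultimately show ?thesis by (rule continuous_on_subset)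
qed

lemma stage_index_mono:
  assumes "0 \<le> s" "s \<le> t"
  shows "stage_index s \<le> stage_index t"
  unfolding stage_index_def using assms by (intro nat_mono floor_mono power_mono) auto

text \<open>Only finitely many switches occur up to \<open>t\<close>, so the fundamental theorem of
  calculus with a finite exceptional set applies. The integrand is bounded, since finitely many
  generators act on a bounded trajectory, hence absolutely integrable.\<close>

lemma switched_flow_integral_equation:
  fixes A :: "nat \<Rightarrow> 'a::euclidean_space \<Rightarrow> 'a"
  assumes "\<And>k. bounded_linear (A k)" "0 \<le> t"
  defines "f \<equiv> \<lambda>x s. A (stage_index s) (switched_flow A s x)"
  shows "f x absolutely_integrable_on {0..t}"
    and "switched_flow A t x = x + integral {0..t} (f x)"
proof -
  let ?S = "(\<lambda>k. sqrt (real k)) ` {..stage_index t}"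
  have integral: "(f x has_integral switched_flow A t x - switched_flow A 0 x) {0..t}"
  proof (rule fundamental_theorem_of_calculus_strong[of ?S])
    fix s assume s: "s \<in> {0..t} - ?S"
    then have "s \<noteq> sqrt (real (stage_index s))" using stage_index_mono[of s t] by auto
    then show "((\<lambda>s. switched_flow A s x) has_vector_derivative f x s) (at s)"
      unfolding f_def using s by (intro switched_flow_has_vector_derivative assms) auto
  qed (use assms continuous_on_switched_flow in auto)
  then show "switched_flow A t x = x + integral {0..t} (f x)"
    by (simp add: integral_unique)
  have "\<exists>B>0. \<forall>y. norm (A k y) \<le> norm y * B" for k
    using bounded_linear.pos_bounded[OF assms(1)] by blast
  then obtain B where B: "\<And>k. 0 < B k" "\<And>k y. norm (A k y) \<le> norm y * B k" by metis
  obtain M where M: "\<And>s. s \<in> {0..t} \<Longrightarrow> norm (switched_flow A s x) \<le> M"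
    using compact_imp_bounded[OF compact_continuous_image[OF continuous_on_switched_flow[OF assms(1)] compact_Icc]]
    unfolding bounded_iff by (meson imageI)
  have M0: "0 \<le> M" using order_trans[OF norm_ge_zero M[of 0]] assms(2) by simp
  \<comment> \<open>The sum serves as a common bound for the finitely many generators in
    use.\<close>
  let ?b = "M * (\<Sum>k\<le>stage_index t. B k)"
  show "f x absolutely_integrable_on {0..t}"
  proof (rule absolutely_integrable_integrable_bound)
    fix s assume s: "s \<in> {0..t}"
    have "norm (f x s) \<le> norm (switched_flow A s x) * B (stage_index s)"
      unfolding f_def by (rule B)
    also have "\<dots> \<le> ?b"
      using s M M0 B(1) stage_index_mono[of s t]
      by (intro mult_mono member_le_sum) (auto intro: less_imp_le)
    finally show "norm (f x s) \<le> ?b" .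
  qed (use integral in \<open>auto simp: has_integral_integrable\<close>)
qed

section \<open>Convergence with controls chosen by feedback\<close>

context controlled_flow
begin

text \<open>Each control is chosen from the state reached at its switch time. Hence \<open>A\<close>
  depends on \<open>x\<close>, but once chosen it is a fixed sequence acting on all states, which
  keeps the evolution linear.\<close>

theorem switched_flow_converges:
  assumes "x \<in> D"
  shows "\<exists>A. (\<forall>k. A k \<in> K) \<and> ((\<lambda>t. switched_flow A t x) \<longlongrightarrow> \<sigma>) at_top"
proof -
  define h where "h k = sqrt (real (Suc k)) - sqrt (real k)" for k
  have h0: "0 \<le> h k" for k by (simp add: h_def)
  have "h \<longlonglongrightarrow> 0"
  proof (rule tendsto_sandwich[OF always_eventually always_eventually tendsto_const])
    show "(\<lambda>k. inverse (sqrt (real (Suc k)))) \<longlonglongrightarrow> 0"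
      by (intro tendsto_inverse_0_at_top filterlim_compose[OF sqrt_at_top]
          filterlim_compose[OF filterlim_real_sequentially] filterlim_Suc)
    show "\<forall>k. h k \<le> inverse (sqrt (real (Suc k)))"
    proof
      fix k
      let ?a = "sqrt (real (Suc k))" and ?b = "sqrt (real k)"
      have "?b * ?b \<le> ?b * ?a" by (intro mult_left_mono) auto
      \<comment> \<open>Replacing \<open>?b * ?a\<close> by the smaller \<open>?b * ?b\<close>
        leaves the difference of squares, which is 1.\<close>
      then have "(?a - ?b) * ?a \<le> 1" by (simp add: algebra_simps)
      then show "h k \<le> inverse ?a" by (simp add: h_def field_simps del: of_nat_Suc)
    qed
  qed (use h0 in auto)
  then obtain e where e: "e \<longlonglongrightarrow> 0" "\<And>k y. y \<in> D \<Longrightarrow> \<exists>A\<in>K. steers (e k) (h k) y A"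
    using steers_along by blast
  then have "\<forall>k y. \<exists>A. y \<in> D \<longrightarrow> A \<in> K \<and> steers (e k) (h k) y A" by blast
  then obtain c where c: "\<And>k y. y \<in> D \<Longrightarrow> c k y \<in> K \<and> steers (e k) (h k) y (c k y)"
    by metis
  \<comment> \<open>The closed-loop states at the switch times; \<open>A\<close> records the
    controls used along them.\<close>
  define X where "X = rec_nat x (\<lambda>k y. flow (c k y) (h k) y)"
  define A where "A k = c k (X k)" for k
  have X: "X k \<in> D" for k
    by (induction k) (use assms invariant c h0 in \<open>auto simp: X_def\<close>)
  have A: "A k \<in> K" "steers (e k) (h k) (X k) (A k)" for k
    using c[OF X] by (auto simp: A_def)
  have stage: "stage A k x = X k" for k
    by (induction k) (auto simp: X_def A_def h_def)
  let ?d = "\<lambda>y. (dist y \<sigma>)\<^sup>2"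
  have dec: "?d (X (Suc k)) \<le> max (e k) (?d (X k) - (h k)\<^sup>2)" for k
  proof -
    have "X (Suc k) = flow (A k) (h k) (X k)" by (simp add: X_def A_def)
    then show ?thesis using A(2)[of k] h0[of k] by (auto simp: steers_def power2_eq_square)
  qed
  have "\<not> summable (\<lambda>k. (h k)\<^sup>2)"
    unfolding h_def by (rule sqrt_gap_squares_not_summable)
  then have dX: "(\<lambda>k. ?d (X k)) \<longlonglongrightarrow> 0"
    by (intro tendsto_0_of_decrements[OF _ _ dec e(1)]) simp_all
  \<comment> \<open>Convergence at the switches extends to all times because \<open>steers\<close>
    also bounds the distance during a dwell.\<close>
  have between: "?d (switched_flow A t x) \<le> max (e (stage_index t)) (?d (X (stage_index t)))"
    if "0 \<le> t" for t
  proof -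
    define k s where "k = stage_index t" and "s = t - sqrt (real k)"
    have s: "s \<in> {0..h k}" using stage_index_bounds[OF that] by (auto simp: k_def s_def h_def)
    then have "?d (flow (A k) s (X k)) \<le> max (e k) (?d (X k) - h k * s)"
      using A(2) by (auto simp: steers_def)
    moreover have "0 \<le> h k * s" using s h0[of k] by auto
    ultimately show ?thesis by (auto simp: switched_flow_def stage k_def s_def)
  qed
  have index: "filterlim stage_index at_top at_top"
    unfolding stage_index_def
    by (intro filterlim_compose[OF filterlim_nat_sequentially]
        filterlim_compose[OF filterlim_floor_sequentially] filterlim_pow_at_top filterlim_ident) simp
  have "((\<lambda>t. max (e (stage_index t)) (?d (X (stage_index t)))) \<longlongrightarrow> max 0 0) at_top"
    by (intro tendsto_max filterlim_compose[OF e(1) index] filterlim_compose[OF dX index])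
  then have upper: "((\<lambda>t. max (e (stage_index t)) (?d (X (stage_index t)))) \<longlongrightarrow> 0) at_top"
    by simp
  have "((\<lambda>t. ?d (switched_flow A t x)) \<longlongrightarrow> 0) at_top"
  proof (rule tendsto_sandwich[OF _ _ tendsto_const upper])
    show "\<forall>\<^sub>F t in at_top. ?d (switched_flow A t x) \<le> max (e (stage_index t)) (?d (X (stage_index t)))"
      using eventually_ge_at_top[of "0::real"] by eventually_elim (rule between)
  qed simp
  from tendsto_real_sqrt[OF this] have "((\<lambda>t. switched_flow A t x) \<longlongrightarrow> \<sigma>) at_top"
    by (simp add: tendsto_dist_iff[of _ \<sigma>])
  then show ?thesis using A(1) by blast
qed

end

section \<open>Lindblad generators\<close>

lemma cadjoint_nth [simp]: "cadjoint A $ i $ j = cnj (A $ j $ i)"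
  by (simp add: cadjoint_def map_matrix_def transpose_def)

lemma cscale_nth [simp]: "cscale c A $ i $ j = c * A $ i $ j"
  by (simp add: cscale_def map_matrix_def)

lemma scaleR_eq_cscale: "r *\<^sub>R A = cscale (of_real r) A"
  by (simp add: vec_eq_iff scaleR_conv_of_real[where 'a = complex])

lemma cadjoint_add: "cadjoint (A + B) = cadjoint A + cadjoint B"
  and cadjoint_diff: "cadjoint (A - B) = cadjoint A - cadjoint B"
  and cadjoint_cscale: "cadjoint (cscale c A) = cscale (cnj c) (cadjoint A)"
  and cadjoint_cadjoint [simp]: "cadjoint (cadjoint A) = A"
  by (simp_all add: vec_eq_iff)

lemma cadjoint_mult: "cadjoint (A ** B) = cadjoint B ** cadjoint A"
  by (simp add: vec_eq_iff matrix_matrix_mult_def mult.commute)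

lemma cadjoint_sum: "cadjoint (\<Sum>j\<in>S. f j) = (\<Sum>j\<in>S. cadjoint (f j))"
  by (simp add: vec_eq_iff)

lemma bounded_linear_cadjoint: "bounded_linear (cadjoint :: 'n::finite operator \<Rightarrow> _)"
  by (intro linear_conv_bounded_linear[THEN iffD1] linearI)
    (simp_all add: cadjoint_add scaleR_eq_cscale cadjoint_cscale)

lemma cscale_mult_left: "cscale c A ** B = cscale c (A ** B)"
  and cscale_mult_right: "A ** cscale c B = cscale c (A ** B)"
  by (simp_all add: vec_eq_iff matrix_matrix_mult_def sum_distrib_left mult_ac)

lemma matrix_add_rdistrib: "(A + B :: 'a::semiring_1 ^ 'n ^ 'm) ** C = A ** C + B ** C"
  by (simp add: vec_eq_iff matrix_matrix_mult_def algebra_simps sum.distrib)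

lemma bounded_linear_trace: "bounded_linear (trace :: 'n::finite operator \<Rightarrow> complex)"
  by (intro linear_conv_bounded_linear[THEN iffD1] linearI)
    (simp_all add: trace_def sum.distrib scaleR_sum_right)

lemma trace_cscale: "trace (cscale c A) = c * trace A"
  by (simp add: trace_def sum_distrib_left)

lemma trace_sum: "trace (\<Sum>j\<in>S. f j :: 'n::finite operator) = (\<Sum>j\<in>S. trace (f j))"
  using linear_sum[OF bounded_linear.linear[OF bounded_linear_trace]] .

text \<open>Identifies the Euclidean geometry of the steering argument with that of the
  Hilbert-Schmidt product.\<close>

lemma Re_hs_inner: "Re (hs_inner A B) = A \<bullet> B"
proof -
  have "Re (hs_inner A B) = (\<Sum>i\<in>UNIV. \<Sum>k\<in>UNIV. A $ k $ i \<bullet> B $ k $ i)"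
    by (simp add: hs_inner_def trace_def matrix_matrix_mult_def inner_complex_def)
  also have "\<dots> = (\<Sum>k\<in>UNIV. \<Sum>i\<in>UNIV. A $ k $ i \<bullet> B $ k $ i)" by (rule sum.swap)
  finally show ?thesis by (simp add: inner_vec_def)
qed

section \<open>Quadratic forms and positivity\<close>

lemma cinner_adjoint: "cinner u (A *v v) = cinner (cadjoint A *v u) v"
proof -
  have "cinner u (A *v v) = (\<Sum>i\<in>UNIV. \<Sum>j\<in>UNIV. cnj (u $ i) * A $ i $ j * v $ j)"
    by (simp add: cinner_def matrix_vector_mult_def sum_distrib_left mult_ac)
  also have "\<dots> = (\<Sum>j\<in>UNIV. \<Sum>i\<in>UNIV. cnj (u $ i) * A $ i $ j * v $ j)" by (rule sum.swap)
  also have "\<dots> = cinner (cadjoint A *v u) v"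
    by (simp add: cinner_def matrix_vector_mult_def sum_distrib_left mult_ac)
  finally show ?thesis .
qed

lemma cinner_commute: "cnj (cinner u v) = cinner v u"
  by (simp add: cinner_def mult.commute)

lemma cinner_zero [simp]: "cinner 0 v = 0" "cinner u 0 = 0"
  by (simp_all add: cinner_def)

lemma cinner_algebra:
  "cinner u (v + w) = cinner u v + cinner u w" "cinner u (v - w) = cinner u v - cinner u w"
  "cinner (u + v) w = cinner u w + cinner v w" "cinner (u - v) w = cinner u w - cinner v w"
  "cinner u (r *\<^sub>R v) = of_real r * cinner u v" "cinner (r *\<^sub>R u) v = of_real r * cinner u v"
  by (simp_all add: cinner_def algebra_simps sum.distrib sum_subtractf sum_distrib_left
      scaleR_conv_of_real[where 'a = complex])

lemma cinner_self: "cinner v v = of_real ((norm v)\<^sup>2)"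
  by (simp add: cinner_def norm_vec_def L2_set_def complex_norm_square[symmetric] sum_nonneg mult.commute)

definition quadratic_form :: "'n::finite operator \<Rightarrow> complex ^ 'n \<Rightarrow> complex" where
  "quadratic_form A v = cinner v (A *v v)"

lemma quadratic_form_linear:
  "quadratic_form (A + B) v = quadratic_form A v + quadratic_form B v"
  "quadratic_form (A - B) v = quadratic_form A v - quadratic_form B v"
  "quadratic_form (cscale c A) v = c * quadratic_form A v"
  by (simp_all add: quadratic_form_def cinner_def matrix_vector_mult_def algebra_simps
      sum.distrib sum_subtractf sum_distrib_left)

lemma quadratic_form_sum:
  "quadratic_form (\<Sum>j\<in>S. f j) v = (\<Sum>j\<in>S. quadratic_form (f j) v)"
  by (induction S rule: infinite_finite_induct)
    (simp_all add: quadratic_form_linear, simp_all add: quadratic_form_def cinner_def matrix_vector_mult_def)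

lemma quadratic_form_scaleR:
  "quadratic_form A (r *\<^sub>R v) = of_real (r\<^sup>2) * quadratic_form A v"
  by (simp add: quadratic_form_def cinner_def matrix_vector_mult_def sum_distrib_left
      scaleR_conv_of_real[where 'a = complex] power2_eq_square mult_ac)

lemma continuous_on_quadratic_form [continuous_intros]:
  assumes "continuous_on S f" "continuous_on S g"
  shows "continuous_on S (\<lambda>x. quadratic_form (f x) (g x))"
  unfolding quadratic_form_def cinner_def matrix_vector_mult_def
  by (simp, intro continuous_intros assms)

lemma bounded_linear_quadratic_form:
  "bounded_linear (\<lambda>A :: 'n::finite operator. quadratic_form A v)"
  by (intro linear_conv_bounded_linear[THEN iffD1] linearI)
    (simp_all add: quadratic_form_linear scaleR_eq_cscale scaleR_conv_of_real[where 'a = complex])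

lemma Im_quadratic_form:
  assumes "selfadjoint_op A"
  shows "Im (quadratic_form A v) = 0"
proof -
  have "cnj (quadratic_form A v) = quadratic_form A v"
    using assms cinner_adjoint[of v A v] by (simp add: quadratic_form_def cinner_commute selfadjoint_op_def)
  then show ?thesis by (metis Reals_cnj_iff complex_is_Real_iff)
qed

lemma positive_op_iff:
  assumes "selfadjoint_op A"
  shows "positive_op A \<longleftrightarrow> (\<forall>v. 0 \<le> Re (quadratic_form A v))"
  using Im_quadratic_form[OF assms]
  by (simp add: positive_op_def less_eq_complex_def quadratic_form_def)

text \<open>By homogeneity; the compactness of the unit sphere is needed to find a first time at
  which positivity fails.\<close>

lemma positive_op_iff_sphere:
  assumes "selfadjoint_op A"
  shows "positive_op A \<longleftrightarrow> (\<forall>v. norm v = 1 \<longrightarrow> 0 \<le> Re (quadratic_form A v))"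
proof -
  have "0 \<le> Re (quadratic_form A v)" if *: "\<forall>v. norm v = 1 \<longrightarrow> 0 \<le> Re (quadratic_form A v)" for v
  proof (cases "v = 0")
    case False
    then have "0 \<le> Re (quadratic_form A ((1 / norm v) *\<^sub>R v))" using * by simp
    then show ?thesis using False by (simp add: quadratic_form_scaleR zero_le_mult_iff not_le)
  qed (simp add: quadratic_form_def)
  then show ?thesis using positive_op_iff[OF assms] by blast
qed

text \<open>Expand the form at \<open>u - v\<close>. This stands in for the Cauchy-Schwarz
  inequality, both for kernels and for matrix entries.\<close>

lemma cinner_cross_bound:
  assumes "selfadjoint_op A" "positive_op A"
  shows "2 * Re (cinner u (A *v v)) \<le> Re (quadratic_form A u) + Re (quadratic_form A v)"
proof -
  have "cinner v (A *v u) = cnj (cinner u (A *v v))"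
    using assms(1) by (simp add: cinner_commute cinner_adjoint[of v] selfadjoint_op_def)
  moreover have "0 \<le> Re (quadratic_form A (u - v))" using assms positive_op_iff by blast
  ultimately show ?thesis
    by (simp add: quadratic_form_def matrix_vector_mult_diff_distrib cinner_algebra)
qed

text \<open>Apply the cross bound to \<open>v\<close> and a small multiple of \<open>A *v v\<close>:
  if that vector were nonzero, the term linear in the multiple would outweigh the quadratic
  one.\<close>

lemma positive_op_kernel:
  assumes A: "selfadjoint_op A" "positive_op A" and "Re (quadratic_form A v) = 0"
  shows "A *v v = 0"
proof (rule ccontr)
  let ?w = "A *v v"
  define N Q where "N = (norm ?w)\<^sup>2" and "Q = Re (quadratic_form A ?w)"
  assume "?w \<noteq> 0"
  then have N: "N > 0" by (simp add: N_def)
  have Q: "Q \<ge> 0" using A positive_op_iff by (auto simp: Q_def)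
  \<comment> \<open>Small enough that \<open>s * Q \<le> N\<close>; the added 1 covers
    \<open>Q = 0\<close>.\<close>
  define s where "s = N / (Q + 1)"
  have "2 * (s * N) \<le> s\<^sup>2 * Q"
    using cinner_cross_bound[OF A, of "s *\<^sub>R ?w" v] assms(3)
    by (simp add: cinner_algebra cinner_self quadratic_form_scaleR N_def Q_def del: of_real_power)
  then have "s * (2 * N) \<le> s * (s * Q)" by (simp add: power2_eq_square mult_ac)
  moreover have "0 < s" using N Q by (simp add: s_def)
  ultimately have "2 * N \<le> s * Q" by (rule mult_left_le_imp_le)
  also have "\<dots> \<le> s * (Q + 1)" using N Q by (intro mult_left_mono) (auto simp: s_def)
  also have "\<dots> = N" using Q by (simp add: s_def)
  finally show False using N by simp
qed

section \<open>Complex-linear superoperators and Lindblad generators\<close>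

lemma linear_cscale_iff:
  fixes f :: "'n::finite superoperator"
  shows "Vector_Spaces.linear cscale cscale f \<longleftrightarrow>
     (\<forall>x y. f (x + y) = f x + f y) \<and> (\<forall>c x. f (cscale c x) = cscale c (f x))"
  by (simp add: Vector_Spaces.linear_iff vector_space_cscale)

lemma linear_cscale_imp_bounded_linear:
  fixes f :: "'n::finite superoperator"
  assumes "Vector_Spaces.linear cscale cscale f"
  shows "bounded_linear f"
  using assms
  by (intro linear_conv_bounded_linear[THEN iffD1] linearI)
    (simp_all add: linear_cscale_iff scaleR_eq_cscale)

lemma bounded_linear_cscale: "bounded_linear (cscale c :: 'n::finite operator \<Rightarrow> _)"
  by (intro linear_conv_bounded_linear[THEN iffD1] linearI) (simp_all add: vec_eq_iff algebra_simps)

lemma lindblad_form_linear: "Vector_Spaces.linear cscale cscale (lindblad_form H n V)"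
proof -
  have "lindblad_form H n V (A + B) = lindblad_form H n V A + lindblad_form H n V B" for A B
    by (simp add: lindblad_form_def vec_eq_iff matrix_add_ldistrib matrix_add_rdistrib algebra_simps
      sum.distrib sum_subtractf)
  moreover have "lindblad_form H n V (cscale c A) = cscale c (lindblad_form H n V A)" for c A
    by (simp add: lindblad_form_def vec_eq_iff cscale_mult_left cscale_mult_right algebra_simps
      sum_distrib_left)
  ultimately show ?thesis
    by (simp add: linear_cscale_iff)
qed

text \<open>Cyclicity of the trace kills the commutator and equates both halves of the
  anticommutator with the jump term.\<close>

lemma trace_lindblad_form: "trace (lindblad_form H n V A) = 0"
proof -
  have "trace (V j ** A ** cadjoint (V j)) = trace (cadjoint (V j) ** V j ** A)"
       "trace (A ** cadjoint (V j) ** V j) = trace (cadjoint (V j) ** V j ** A)" for j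
    by (metis trace_mul_sym matrix_mul_assoc)+
  then show ?thesis
    by (simp add: lindblad_form_def trace_add trace_sub trace_cscale trace_sum trace_mul_sym[of A H])
qed

text \<open>The adjoint reverses the commutator and conjugates \<open>- \<i>\<close>; the two sign
  changes cancel.\<close>

lemma cadjoint_lindblad_form:
  assumes "selfadjoint_op H"
  shows "cadjoint (lindblad_form H n V A) = lindblad_form H n V (cadjoint A)"
proof -
  have H: "cadjoint H = H" using assms unfolding selfadjoint_op_def by (rule sym)
  show ?thesis
    by (simp add: lindblad_form_def cadjoint_add cadjoint_diff cadjoint_cscale cadjoint_sum cadjoint_mult
        H matrix_mul_assoc vec_eq_iff algebra_simps)
qed

text \<open>Infinitesimal positivity: on the kernel of \<open>A\<close>, terms with \<open>A\<close>
  at an outer end vanish, and each jump term is the form of \<open>A\<close> at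
  \<open>cadjoint (V j) *v v\<close>.\<close>

lemma lindblad_form_nonneg_on_kernel:
  assumes A: "selfadjoint_op A" "positive_op A" and v: "A *v v = 0"
  shows "0 \<le> Re (quadratic_form (lindblad_form H n V A) v)"
proof -
  have left: "quadratic_form (A ** B) v = 0" for B
    using A(1) cinner_adjoint[of v A "B *v v"] v
    by (simp add: quadratic_form_def selfadjoint_op_def matrix_vector_mul_assoc[symmetric])
  have right: "quadratic_form (B ** A) v = 0" for B
    using v by (simp add: quadratic_form_def matrix_vector_mul_assoc[symmetric])
  have "quadratic_form (B ** A ** cadjoint B) v = quadratic_form A (cadjoint B *v v)" for B
    by (simp add: quadratic_form_def matrix_vector_mul_assoc[symmetric] cinner_adjoint[of v B])
  moreover have "0 \<le> Re (quadratic_form A u)" for u using A positive_op_iff by blast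
  moreover have "quadratic_form (A ** cadjoint B ** B) v = 0" for B
    using left[of "cadjoint B ** B"] by (simp add: matrix_mul_assoc)
  ultimately show ?thesis
    by (simp add: lindblad_form_def quadratic_form_linear quadratic_form_sum left right sum_nonneg)
qed

section \<open>Invariance of the density operators\<close>

lemma linear_cscale_flow:
  assumes "Vector_Spaces.linear cscale cscale A"
  shows "Vector_Spaces.linear cscale cscale (flow A t)"
proof -
  have A: "bounded_linear A" using linear_cscale_imp_bounded_linear[OF assms] .
  have "flow A t (cscale c x) = cscale c (flow A t x)" for c x
    using assms by (intro flow_commute[OF A bounded_linear_cscale]) (simp add: linear_cscale_iff)
  then show ?thesis by (simp add: linear_cscale_iff flow_add[OF A])
qed

lemma linear_cscale_switched_flow:
  assumes "\<And>k. Vector_Spaces.linear cscale cscale (A k)"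
  shows "Vector_Spaces.linear cscale cscale (switched_flow A t)"
proof -
  have "Vector_Spaces.linear cscale cscale (stage A k)" for k
    by (induction k) (use linear_cscale_flow[OF assms] in \<open>auto simp: linear_cscale_iff\<close>)
  then show ?thesis
    using linear_cscale_flow[OF assms] by (simp add: linear_cscale_iff switched_flow_def)
qed

text \<open>For boundedness, positivity and the trace put the diagonal entries between 0 and 1, and
  the cross bound on basis vectors carries this over to all entries.\<close>

lemma compact_density_ops: "compact (density_ops :: 'n::finite operator set)"
proof -
  have "norm (A $ i $ j) \<le> 1" if A: "A \<in> density_ops" for A :: "'n operator" and i j
  proof -
    have sa: "selfadjoint_op A" and pos: "positive_op A" and tr: "trace A = 1"
      using A by (auto simp: density_ops_def)
    have entry: "cinner (axis k c) (A *v axis l d) = cnj c * A $ k $ l * d" for k l c d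
      by (simp add: cinner_def matrix_vector_mult_def axis_def if_distrib[of "\<lambda>z. _ * z"]
          if_distrib[of cnj] if_distrib[of "\<lambda>z. z * _"] cong: if_cong)
    have diag_nonneg: "0 \<le> Re (A $ k $ k)" for k
      using pos positive_op_iff[OF sa] entry[of k 1 k 1]
      by (metis mult_1 mult_1_right complex_cnj_one quadratic_form_def)
    have diag: "Re (A $ k $ k) \<le> 1" for k
    proof -
      have "Re (A $ k $ k) \<le> (\<Sum>l\<in>UNIV. Re (A $ l $ l))"
        by (rule member_le_sum) (use diag_nonneg in auto)
      also have "\<dots> = Re (trace A)" by (simp add: trace_def)
      finally show ?thesis using tr by simp
    qed
    \<comment> \<open>The phase that turns the entry into its absolute value. It is 0 for a zero
      entry, so only \<open>norm c \<le> 1\<close> is available.\<close>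
    define c where "c = cnj (sgn (A $ i $ j))"
    have "A $ i $ j * c = of_real (norm (A $ i $ j))"
      by (simp add: c_def sgn_eq complex_norm_square[symmetric] power2_eq_square)
    then have "2 * norm (A $ i $ j) \<le> Re (A $ i $ i) + Re (cnj c * A $ j $ j * c)"
      using cinner_cross_bound[OF sa pos, of "axis i 1" "axis j c"]
      by (simp add: quadratic_form_def entry)
    also have "cnj c * A $ j $ j * c = of_real ((norm c)\<^sup>2) * A $ j $ j"
      by (simp add: complex_norm_square mult_ac del: of_real_power)
    also have "Re (of_real ((norm c)\<^sup>2) * A $ j $ j) \<le> 1 * Re (A $ j $ j)"
      using diag_nonneg[of j] by (simp add: c_def norm_sgn del: of_real_power)
    finally show ?thesis using diag[of i] diag[of j] by linarith
  qed
  then have "norm A \<le> norm (\<chi> i j. 1 :: 'n operator)" if "A \<in> density_ops" for A :: "'n operator"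
    using that by (intro norm_le_componentwise_cart) simp
  then have "bounded (density_ops :: 'n operator set)" by (auto simp: bounded_iff)
  moreover have "density_ops = {A :: 'n operator. A = cadjoint A} \<inter> {A. trace A = 1} \<inter>
      {A. \<forall>v. 0 \<le> Re (quadratic_form A v)}"
    using positive_op_iff by (auto simp: density_ops_def selfadjoint_op_def)
  moreover have "closed \<dots>"
    by (intro closed_Int closed_Collect_eq closed_Collect_all closed_Collect_le continuous_intros
        linear_continuous_on bounded_linear_cadjoint bounded_linear_trace)
  ultimately show ?thesis by (simp add: compact_eq_bounded_closed)
qed

text \<open>At a first time where \<open>\<langle>v, Z(t) v\<rangle>\<close> vanishes for a unit vector \<open>v\<close>, the operator \<open>Z(t)\<close> is
  positive with \<open>v\<close> in its kernel, so the strict inequality for \<open>Z'\<close> says that the form was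
  negative just before.\<close>

lemma positive_of_strict_subsolution:
  fixes Z Z' :: "real \<Rightarrow> 'n::finite operator"
  assumes deriv: "\<And>t. (Z has_vector_derivative Z' t) (at t)"
    and sa: "\<And>t. selfadjoint_op (Z t)"
    and init: "\<And>v. norm v = 1 \<Longrightarrow> 0 < Re (quadratic_form (Z 0) v)"
    and strict: "\<And>t v. positive_op (Z t) \<Longrightarrow> norm v = 1 \<Longrightarrow> Z t *v v = 0 \<Longrightarrow>
      0 < Re (quadratic_form (Z' t) v)"
    and T: "0 \<le> T"
  shows "positive_op (Z T)"
proof (rule ccontr)
  let ?q = "\<lambda>t v. Re (quadratic_form (Z t) v)"
  \<comment> \<open>Joint continuity of the form makes this set compact, so its times have a least
    element.\<close>
  let ?S = "({0..T} \<times> sphere 0 1) \<inter> {p. ?q (fst p) (snd p) \<le> 0}"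
  assume "\<not> positive_op (Z T)"
  then obtain w where w: "norm w = 1" "?q T w < 0"
    using positive_op_iff_sphere[OF sa, of T] by (meson not_le)
  have Z: "continuous_on S Z" for S
    using has_vector_derivative_continuous[OF deriv]
    by (intro continuous_at_imp_continuous_on) auto
  have "closed {p :: real \<times> (complex ^ 'n). ?q (fst p) (snd p) \<le> 0}"
    by (intro closed_Collect_le continuous_intros continuous_on_compose2[OF Z]) auto
  then have "compact ?S" by (intro compact_Int_closed compact_Times) auto
  then have "compact (fst ` ?S)" by (intro compact_continuous_image continuous_intros)
  moreover have "(T, w) \<in> ?S" using w T by auto
  ultimately obtain t where t: "t \<in> fst ` ?S" and first: "\<And>s. s \<in> fst ` ?S \<Longrightarrow> t \<le> s"
    using compact_attains_inf[of "fst ` ?S"] by blast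
  then obtain v where v: "norm v = 1" "?q t v \<le> 0" and tT: "0 \<le> t" "t \<le> T" by auto
  have "t \<noteq> 0" using init[OF v(1)] v(2) by auto
  then have t0: "0 < t" using tT by simp
  have before: "0 < ?q s u" if "0 \<le> s" "s < t" "norm u = 1" for s u
  proof (rule ccontr)
    assume "\<not> ?thesis"
    then have "(s, u) \<in> ?S" using that tT by auto
    then show False using first[of s] that(2) by force
  qed
  \<comment> \<open>Left limits of the strict positivity before \<open>t\<close>.\<close>
  have "0 \<le> ?q t u" if "norm u = 1" for u
  proof (rule tendsto_lowerbound)
    show "((\<lambda>s. ?q s u) \<longlongrightarrow> ?q t u) (at_left t)"
      using has_vector_derivative_continuous[OF deriv, of t]
      by (intro tendsto_Re bounded_linear.tendsto[OF bounded_linear_quadratic_form])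
        (auto simp: continuous_within intro: tendsto_within_subset)
    show "\<forall>\<^sub>F s in at_left t. 0 \<le> ?q s u"
      unfolding eventually_at_left_field
      using before[OF _ _ that] t0 by (intro exI[of _ 0]) (auto intro: less_imp_le)
  qed simp
  then have pos: "positive_op (Z t)" using positive_op_iff_sphere[OF sa] by blast
  then have q0: "?q t v = 0" using v positive_op_iff[OF sa] by (metis antisym)
  have "((\<lambda>s. ?q s v) has_vector_derivative Re (quadratic_form (Z' t) v)) (at t)"
    using bounded_linear.has_vector_derivative[OF bounded_linear_compose[OF bounded_linear_Re
        bounded_linear_quadratic_form] deriv] by simp
  then have "DERIV (\<lambda>s. ?q s v) t :> Re (quadratic_form (Z' t) v)"
    by (simp add: has_real_derivative_iff_has_vector_derivative)
  moreover have "0 < Re (quadratic_form (Z' t) v)"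
    using strict[OF pos v(1) positive_op_kernel[OF sa pos q0]] .
  ultimately obtain d where d: "d > 0" "\<And>h. 0 < h \<Longrightarrow> h < d \<Longrightarrow> ?q (t - h) v < ?q t v"
    using DERIV_pos_inc_left by blast
  \<comment> \<open>The cap by \<open>t\<close> keeps \<open>t - h\<close> nonnegative, within the
    range of \<open>before\<close>.\<close>
  define h where "h = min (d / 2) t"
  have "?q (t - h) v < 0" using d t0 q0 by (auto simp: h_def)
  moreover have "0 < ?q (t - h) v" using before[OF _ _ v(1)] d(1) t0 by (auto simp: h_def)
  ultimately show False by simp
qed

section \<open>Lindblad semigroups on density operators\<close>

lemma quadratic_form_mat_1: "quadratic_form (mat 1) v = of_real ((norm v)\<^sup>2)"
  by (simp add: quadratic_form_def cinner_self)

lemma flow_lindblad_form_selfadjoint: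
  assumes "selfadjoint_op H" "selfadjoint_op A"
  shows "selfadjoint_op (flow (lindblad_form H n V) t A)"
proof -
  have A: "cadjoint A = A" using assms(2) unfolding selfadjoint_op_def by (rule sym)
  have "flow (lindblad_form H n V) t (cadjoint A) = cadjoint (flow (lindblad_form H n V) t A)"
    using linear_cscale_imp_bounded_linear[OF lindblad_form_linear] bounded_linear_cadjoint
    by (rule flow_commute) (rule cadjoint_lindblad_form[OF assms(1)])
  then show ?thesis unfolding selfadjoint_op_def A .
qed

lemma flow_lindblad_form_trace:
  fixes A :: "'n::finite operator"
  shows "trace (flow (lindblad_form H n V) t A) = trace A"
proof -
  have "((\<lambda>s. trace (flow (lindblad_form H n V) s A)) has_vector_derivative 0) (at s within UNIV)" for s
    using bounded_linear.has_vector_derivative[OF bounded_linear_trace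
        flow_has_vector_derivative[OF linear_cscale_imp_bounded_linear[OF lindblad_form_linear]], of H n V A s]
    by (simp add: trace_lindblad_form)
  from has_vector_derivative_zero_constant[OF convex_UNIV this]
  obtain c where "\<And>s. trace (flow (lindblad_form H n V) s A) = c" by auto
  from this[of t] this[of 0] show ?thesis by simp
qed

text \<open>Infinitesimal positivity holds only weakly, so a small multiple of the identity growing
  like \<open>exp (l * t)\<close> is added. For \<open>l\<close> above the form of
  \<open>?L ?I\<close> on the unit sphere the inequality becomes strict; then the perturbation is
  sent to zero.\<close>

lemma flow_lindblad_form_positive:
  fixes A H :: "'n::finite operator"
  assumes H: "selfadjoint_op H" and A: "selfadjoint_op A" "positive_op A" and t: "0 \<le> t"
  shows "positive_op (flow (lindblad_form H n V) t A)"
proof -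
  let ?L = "lindblad_form H n V" and ?I = "mat 1 :: 'n operator"
  let ?X = "\<lambda>t. flow ?L t A"
  have L: "bounded_linear ?L" using linear_cscale_imp_bounded_linear[OF lindblad_form_linear] .
  have sa: "selfadjoint_op (?X t)" for t using flow_lindblad_form_selfadjoint[OF H A(1)] .
  have "compact ((\<lambda>v. Re (quadratic_form (?L ?I) v)) ` sphere 0 1)"
    by (intro compact_continuous_image continuous_intros) simp
  then obtain M where M: "\<And>v. norm v = 1 \<Longrightarrow> Re (quadratic_form (?L ?I) v) \<le> M"
    by (metis bounded_imp_bdd_above compact_imp_bounded bdd_above_def imageI mem_sphere_0)
  define l where "l = M + 1"
  have pert: "positive_op (?X t + (e * exp (l * t)) *\<^sub>R ?I)" if e: "e > 0" for e
  proof (rule positive_of_strict_subsolution[where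
        Z = "\<lambda>t. ?X t + (e * exp (l * t)) *\<^sub>R ?I"
        and Z' = "\<lambda>t. ?L (?X t) + (l * (e * exp (l * t))) *\<^sub>R ?I"])
    fix t
    have "((\<lambda>t. e * exp (l * t)) has_field_derivative l * (e * exp (l * t))) (at t)"
      by (auto intro!: derivative_eq_intros)
    then have "((\<lambda>t. (e * exp (l * t)) *\<^sub>R ?I) has_vector_derivative (l * (e * exp (l * t))) *\<^sub>R ?I) (at t)"
      using has_vector_derivative_scaleR[OF _ has_vector_derivative_const, of _ _ t UNIV ?I] by simp
    then show "((\<lambda>t. ?X t + (e * exp (l * t)) *\<^sub>R ?I) has_vector_derivative
        ?L (?X t) + (l * (e * exp (l * t))) *\<^sub>R ?I) (at t)"
      by (rule has_vector_derivative_add[OF flow_has_vector_derivative[OF L]])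
    let ?Z = "?X t + (e * exp (l * t)) *\<^sub>R ?I"
    have "cadjoint ?I = ?I" by (auto simp: vec_eq_iff mat_def)
    then show saZ: "selfadjoint_op ?Z"
      using sa[of t, unfolded selfadjoint_op_def, symmetric]
      by (simp add: selfadjoint_op_def cadjoint_add scaleR_eq_cscale cadjoint_cscale)
    fix v :: "complex ^ 'n" assume v: "norm v = 1"
    assume Z: "positive_op ?Z" "?Z *v v = 0"
    \<comment> \<open>The kernel estimate concerns \<open>?L ?Z\<close>; the derivative of
      \<open>?Z\<close> differs from it by \<open>e * exp (l * t)\<close> times
      \<open>l *\<^sub>R ?I - ?L ?I\<close>, whose form at \<open>v\<close> is positive.\<close>
    have eq: "?L ?Z = ?L (?X t) + (e * exp (l * t)) *\<^sub>R ?L ?I"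
      using linear_add[OF bounded_linear.linear[OF L]] linear_cmul[OF bounded_linear.linear[OF L]] by simp
    have "0 \<le> Re (quadratic_form (?L (?X t) + (e * exp (l * t)) *\<^sub>R ?L ?I) v)"
      using lindblad_form_nonneg_on_kernel[OF saZ Z, of H n V] unfolding eq .
    moreover have "(e * exp (l * t)) * Re (quadratic_form (?L ?I) v) < (e * exp (l * t)) * l"
      using M[OF v] e by (intro mult_strict_left_mono) (auto simp: l_def)
    ultimately show "0 < Re (quadratic_form (?L (?X t) + (l * (e * exp (l * t))) *\<^sub>R ?I) v)"
      using v by (simp add: quadratic_form_linear scaleR_eq_cscale quadratic_form_mat_1 mult_ac)
  next
    fix v :: "complex ^ 'n" assume "norm v = 1"
    then show "0 < Re (quadratic_form (?X 0 + (e * exp (l * 0)) *\<^sub>R ?I) v)"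
      using A positive_op_iff[of A] e
      by (simp add: quadratic_form_linear scaleR_eq_cscale quadratic_form_mat_1 add_nonneg_pos)
  qed (rule t)
  have "0 \<le> Re (quadratic_form (?X t) v)" if v: "norm v = 1" for v
  proof (rule field_le_epsilon)
    fix d :: real assume d: "0 < d"
    \<comment> \<open>Makes the perturbation at time \<open>t\<close> exactly \<open>d\<close> times
      the identity.\<close>
    define e where "e = d / exp (l * t)"
    have "positive_op (?X t + d *\<^sub>R ?I)" using pert[of e] d by (simp add: e_def)
    then have "0 \<le> cinner v ((?X t + d *\<^sub>R ?I) *v v)" by (simp add: positive_op_def)
    then show "0 \<le> Re (quadratic_form (?X t) v) + d"
      using v
      by (simp add: less_eq_complex_def quadratic_form_linear scaleR_eq_cscale quadratic_form_mat_1
          quadratic_form_def[symmetric])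
  qed
  then show ?thesis using positive_op_iff_sphere[OF sa] by blast
qed

lemma flow_lindbladian_density_ops:
  assumes "A \<in> lindbladians" "\<rho> \<in> density_ops" "0 \<le> t"
  shows "flow A t \<rho> \<in> density_ops"
proof -
  obtain H n V where A: "A = lindblad_form H n V" and H: "selfadjoint_op H"
    using assms(1) unfolding lindbladians_def by blast
  show ?thesis
    using assms(2,3) flow_lindblad_form_selfadjoint[OF H] flow_lindblad_form_positive[OF H]
    unfolding density_ops_def A by (simp add: flow_lindblad_form_trace)
qed

section \<open>Reaching the target state\<close>

theorem corollary4p5:
  fixes K :: "'n::finite superoperator set"
    and \<sigma> :: "'n operator"
    and L :: "'n operator \<Rightarrow> 'n superoperator"
  assumes "K \<subseteq> lindbladians"
    and "\<sigma> \<in> density_ops"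
    and "\<And>\<eta>. \<eta> \<in> density_ops \<Longrightarrow> L \<eta> \<in> K"
    and "\<And>\<eta>. \<eta> \<in> density_ops \<Longrightarrow> \<eta> \<noteq> \<sigma> \<Longrightarrow> 0 < hs_inner (L \<eta> \<eta>) (\<sigma> - \<eta>)"
  shows "reaches K \<sigma>"
  unfolding reaches_def
proof
  \<comment> \<open>Complex linearity is what \<open>evolution\<close> asks for; the real bounded
    linearity derived from it serves the locale.\<close>
  have clinear: "Vector_Spaces.linear cscale cscale A" if A: "A \<in> K" for A
  proof -
    obtain H n V where "A = lindblad_form H n V"
      using subsetD[OF assms(1) A] unfolding lindbladians_def by blast
    then show ?thesis by (simp only: lindblad_form_linear)
  qed
  have bounded: "bounded_linear A" if "A \<in> K" for A
    using linear_cscale_imp_bounded_linear[OF clinear[OF that]] .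
  interpret controlled_flow density_ops K \<sigma> L
  proof (rule controlled_flow.intro)
    show "compact density_ops" by (rule compact_density_ops)
    show "bounded_linear A" if "A \<in> K" for A using bounded[OF that] .
    show "L x \<in> K" if "x \<in> density_ops" for x using assms(3)[OF that] .
    show "flow A t x \<in> density_ops" if "A \<in> K" "x \<in> density_ops" "0 \<le> t" for A x t
      using flow_lindbladian_density_ops[OF subsetD[OF assms(1) that(1)] that(2,3)] .
    show "0 < L \<eta> \<eta> \<bullet> (\<sigma> - \<eta>)" if "\<eta> \<in> density_ops" "\<eta> \<noteq> \<sigma>" for \<eta>
      using assms(4)[OF that] by (simp add: less_complex_def Re_hs_inner)
  qed
  fix \<rho> :: "'n operator" assume "\<rho> \<in> density_ops"
  then obtain A where A: "\<And>k. A k \<in> K" "((\<lambda>t. switched_flow A t \<rho>) \<longlongrightarrow> \<sigma>) at_top"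
    using switched_flow_converges by blast
  have "weak_solution (\<lambda>t. A (stage_index t)) (switched_flow A)"
    using switched_flow_integral_equation[of A, OF bounded[OF A(1)]]
    by (simp add: weak_solution_def)
  then have "\<exists>G. (\<forall>t\<ge>0. G t \<in> K) \<and> weak_solution G (switched_flow A)"
    by (intro exI[of _ "\<lambda>t. A (stage_index t)"]) (simp add: A(1))
  moreover have "switched_flow A 0 = id" by (rule ext) simp
  then have "evolution (switched_flow A)"
    unfolding evolution_def using linear_cscale_switched_flow[of A, OF clinear[OF A(1)]] by blast
  ultimately have "admissible K (switched_flow A)" by (simp only: admissible_def simp_thms)
  with A(2) show "\<exists>T. admissible K T \<and> ((\<lambda>t. T t \<rho>) \<longlongrightarrow> \<sigma>) at_top"
    by (intro exI[of _ "switched_flow A"] conjI)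
qed

end
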